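(* Let $n\ge 5$ and let $B$ be the real $n\times n$ matrix $$B=\begin{bmatrix} a_1&1&1&\cdots&1\\ a_2&0&&&\\ a_3&&-b_1&&\\ \vdots&&&\ddots&\\ a_n&&&&-b_{n-2}\end{bmatrix}$$ (all unspecified entries zero), where $b_j>0$ for $j=1,\dots,n-3$ and the real numbers $a_1,\dots,a_n,b_{n-2}$ are such that $B\in Q(\mathcal{A}_i)$ for some $i\in\{1,2,3\}$. If $b_1,\dots,b_{n-2}$ are pairwise distinct, then $\mathrm{ri}(B)\in\mathbb{H}_n=\{(0,n,0,0),(0,n-2,0,2),(2,n-2,0,0)\}$.
   Context: The refined inertia of a real square matrix $B$ is $\mathrm{ri}(B)=(n_+(B),n_-(B),n_z(B),2n_p(B))$, where $n_+$ (resp. $n_-$) is the number of eigenvalues (with multiplicity) with positive (resp. negative) real part, $n_z$ is the number of zero eigenvalues, and $2n_p$ is the number of nonzero pure imaginary eigenvalues. For an $n\times n$ sign pattern $\mathcal{A}$ (matrix with entries in $\{+,-,0\}$), $Q(\mathcal{A})$ is the set of real matrices whose entrywise signs equal $\mathcal{A}$. The $n\times n$ sign patterns are: in all three, every off-diagonal entry not in the first row or first column is $0$, and the $(2,2)$ entry is $0$. $\mathcal{A}_1$: $(1,1)$ entry $+$, entries $(1,j)$, $j\ge2$, are $+$, entries $(j,1)$, $j\ge 2$, are $-$, diagonal entries $(j,j)$, $3\le j\le n$, are $-$. $\mathcal{A}_2$: $(1,1)$ entry $-$, entries $(1,j)$, $j\ge 2$, are $+$, $(2,1)$ entry $-$,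 entries $(j,1)$, $3\le j\le n$, are $+$, diagonal entries $(j,j)$, $3\le j\le n$, are $-$. $\mathcal{A}_3$: $(1,1)$ entry $-$, entries $(1,j)$, $j\ge2$, are $+$, entries $(j,1)$, $2\le j\le n-1$, are $+$, $(n,1)$ entry $-$, diagonal entries $(j,j)$, $3\le j\le n-1$, are $-$, and $(n,n)$ entry $+$. *)

theory Defs
  imports "Jordan_Normal_Form.Char_Poly"
begin

text \<open>Matrices of \<^theory>\<open>Jordan_Normal_Form.Matrix\<close> are indexed from 0. The matrices here are given by
  their entries with the customary 1-based indices \<^term>\<open>i\<close>, \<^term>\<open>j\<close> in \<^term>\<open>{1..n}\<close>.\<close>

definition mat1 :: "nat \<Rightarrow> (nat \<Rightarrow> nat \<Rightarrow> 'a) \<Rightarrow> 'a mat" where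
  "mat1 n f = mat n n (\<lambda>(i, j). f (Suc i) (Suc j))"

datatype sign_entry = SPos | SNeg | SZero

definition sign_of :: "real \<Rightarrow> sign_entry" where
  "sign_of x = (if x > 0 then SPos else if x < 0 then SNeg else SZero)"

definition qual_class :: "sign_entry mat \<Rightarrow> real mat set" where
  "qual_class A = {B. map_mat sign_of B = A}"

text \<open>Number of complex eigenvalues satisfying \<^term>\<open>P\<close>, counted with algebraic multiplicity.
  Meaningful for square matrices only.\<close>

definition eigenvalue_count :: "real mat \<Rightarrow> (complex \<Rightarrow> bool) \<Rightarrow> nat" where
  "eigenvalue_count B P =
     (\<Sum>z | eigenvalue (map_mat complex_of_real B) z \<and> P z.
        order z (char_poly (map_mat complex_of_real B)))"

text \<open>The last component counts all nonzero purely imaginary eigenvalues, i.e. it is $2n_p$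
  and not the number $n_p$ of conjugate pairs.\<close>

definition refined_inertia :: "real mat \<Rightarrow> nat \<times> nat \<times> nat \<times> nat" where
  "refined_inertia B =
     (eigenvalue_count B (\<lambda>z. Re z > 0),
      eigenvalue_count B (\<lambda>z. Re z < 0),
      eigenvalue_count B (\<lambda>z. z = 0),
      eigenvalue_count B (\<lambda>z. Re z = 0 \<and> z \<noteq> 0))"

definition H_set :: "nat \<Rightarrow> (nat \<times> nat \<times> nat \<times> nat) set" where
  "H_set n = {(0, n, 0, 0), (0, n - 2, 0, 2), (2, n - 2, 0, 0)}"

definition pattern_A1 :: "nat \<Rightarrow> sign_entry mat" where
  "pattern_A1 n = mat1 n (\<lambda>i j.
     if i = 1 then SPos
     else if j = 1 then SNeg
     else if i = j \<and> 3 \<le> i then SNeg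
     else SZero)"

definition pattern_A2 :: "nat \<Rightarrow> sign_entry mat" where
  "pattern_A2 n = mat1 n (\<lambda>i j.
     if i = 1 then (if j = 1 then SNeg else SPos)
     else if j = 1 then (if i = 2 then SNeg else SPos)
     else if i = j \<and> 3 \<le> i then SNeg
     else SZero)"

definition pattern_A3 :: "nat \<Rightarrow> sign_entry mat" where
  "pattern_A3 n = mat1 n (\<lambda>i j.
     if i = 1 then (if j = 1 then SNeg else SPos)
     else if j = 1 then (if i = n then SNeg else SPos)
     else if i = j \<and> 3 \<le> i then (if i = n then SPos else SNeg)
     else SZero)"

text \<open>Only the values \<^term>\<open>a i\<close> for \<^term>\<open>i \<in> {1..n}\<close> and \<^term>\<open>b j\<close> for \<^term>\<open>j \<in> {1..n-2}\<close> enter.\<close>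

definition matrix_B :: "nat \<Rightarrow> (nat \<Rightarrow> real) \<Rightarrow> (nat \<Rightarrow> real) \<Rightarrow> real mat" where
  "matrix_B n a b = mat1 n (\<lambda>i j.
     if j = 1 then a i
     else if i = 1 then 1
     else if i = j \<and> 3 \<le> i then - b (i - 2)
     else 0)"

end

theory Submission
  imports Defs "HOL-Computational_Algebra.Fundamental_Theorem_Algebra"
begin

text \<open>Write \<open>p\<close> for the characteristic polynomial and \<open>c\<^sub>2 = 0\<close>, \<open>c\<^sub>i = - b\<^bsub>i - 2\<^esub>\<close> for the diagonal of the
  arrow matrix below its first entry. Then \<open>p(c\<^sub>k) = - a\<^sub>k \<Prod>\<^bsub>j \<noteq> k\<^esub> (c\<^sub>k - c\<^sub>j)\<close>, and in each of the three
  patterns these signs, together with the sign of \<open>p\<close> at \<open>-\<infinity>\<close>, make \<open>p\<close> alternate along \<open>n - 1\<close> points of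
  \<open>(-\<infinity>, 0]\<close>. So \<open>p\<close> has \<open>n - 2\<close> distinct negative roots. Since \<open>p(0) > 0\<close>, the remaining two roots
  have positive product: they are real of the same sign or form a conjugate pair, hence their real parts
  are both positive, both negative, or both zero.\<close>

section \<open>Determinant of an arrow matrix\<close>

text \<open>The factor next to the product is the Schur complement of the diagonal block of the
  \<open>d i\<close> with \<open>i >= 1\<close>, which is invertible because these entries are
  nonzero.\<close>

lemma det_arrow:
  fixes d u v :: "nat \<Rightarrow> 'a :: field"
  assumes n: "n > 0" and nz: "\<And>i. i \<in> {1..<n} \<Longrightarrow> d i \<noteq> 0"
  shows "det (mat n n (\<lambda>(i, j). if i = j then d i else if i = 0 then u j else if j = 0 then v i else 0))
    = (d 0 - (\<Sum>i\<in>{1..<n}. u i * v i / d i)) * (\<Prod>i\<in>{1..<n}. d i)"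
proof -
  \<comment> \<open>Right multiplication by \<open>L\<close> clears the first column below the corner.\<close>
  define M where "M = mat n n (\<lambda>(i, j). if i = j then d i else if i = 0 then u j else if j = 0 then v i else 0)"
  define L where "L = mat n n (\<lambda>(i, j). if i = j then 1 else if j = 0 then - v i / d i else 0)"
  have carr: "M \<in> carrier_mat n n" "L \<in> carrier_mat n n" "M * L \<in> carrier_mat n n"
    by (auto simp: M_def L_def)
  have split: "{0..<n} = insert 0 {1..<n}" using n by auto
  have entry: "(M * L) $$ (i, j) = (\<Sum>k\<in>{0..<n}. M $$ (i, k) * L $$ (k, j))"
    if "i < n" "j < n" for i j
    using that carr by (simp add: scalar_prod_def)
  have col: "(M * L) $$ (i, j) = M $$ (i, j)" if "i < n" "j < n" "j \<noteq> 0" for i j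
  proof -
    have "(M * L) $$ (i, j) = (\<Sum>k\<in>{0..<n}. if k = j then M $$ (i, j) else 0)"
      unfolding entry[OF that(1,2)] using that by (intro sum.cong) (auto simp: L_def)
    then show ?thesis using that by simp
  qed
  have col0: "(M * L) $$ (i, 0) = 0" if "i < n" "i \<noteq> 0" for i
  proof -
    have "(M * L) $$ (i, 0) = v i + (\<Sum>k\<in>{1..<n}. M $$ (i, k) * L $$ (k, 0))"
      unfolding entry[OF that(1) n] split using that n by (simp add: M_def L_def)
    also have "(\<Sum>k\<in>{1..<n}. M $$ (i, k) * L $$ (k, 0)) = (\<Sum>k\<in>{1..<n}. if k = i then - v i else 0)"
      using that nz by (intro sum.cong) (auto simp: M_def L_def)
    finally show ?thesis using that by simp
  qed
  have corner: "(M * L) $$ (0, 0) = d 0 - (\<Sum>i\<in>{1..<n}. u i * v i / d i)"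
  proof -
    have "(M * L) $$ (0, 0) = d 0 + (\<Sum>k\<in>{1..<n}. M $$ (0, k) * L $$ (k, 0))"
      unfolding entry[OF n n] split using n by (simp add: M_def L_def)
    also have "(\<Sum>k\<in>{1..<n}. M $$ (0, k) * L $$ (k, 0)) = (\<Sum>k\<in>{1..<n}. - (u k * v k / d k))"
      by (intro sum.cong) (auto simp: M_def L_def)
    finally show ?thesis by (simp add: sum_negf)
  qed
  have "det L = 1"
    by (subst det_lower_triangular[of n]) (auto simp: L_def prod_list_diag_prod)
  then have "det M = det (M * L)"
    using carr by (simp add: det_mult)
  also have "\<dots> = (\<Prod>i\<in>{0..<n}. (M * L) $$ (i, i))"
  proof -
    have "upper_triangular (M * L)"
      unfolding upper_triangular_def
    proof (intro allI impI)
      fix i j assume "i < dim_row (M * L)" "j < i"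
      then show "(M * L) $$ (i, j) = 0"
        using carr col[of i j] col0[of i] by (cases "j = 0") (auto simp: M_def simp del: index_mult_mat)
    qed
    then show ?thesis
      using det_upper_triangular[OF _ carr(3)] carr by (simp add: prod_list_diag_prod)
  qed
  also have "\<dots> = (M * L) $$ (0, 0) * (\<Prod>i\<in>{1..<n}. (M * L) $$ (i, i))"
    unfolding split by simp
  also have "(\<Prod>i\<in>{1..<n}. (M * L) $$ (i, i)) = (\<Prod>i\<in>{1..<n}. d i)"
    by (intro prod.cong refl) (subst col, auto simp: M_def)
  finally show ?thesis
    unfolding corner by (simp add: M_def)
qed

section \<open>Real roots from alternating signs\<close>

lemma sgn_prod_less:
  fixes m :: real
  assumes "finite T" "\<And>t. t \<in> T \<Longrightarrow> m < t"
  shows "sgn (\<Prod>t\<in>T. m - t) = (-1) ^ card T"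
  using assms by (induction T rule: finite_induct) (auto simp: sgn_mult)

text \<open>The product at \<open>s\<close> has sign (-1)^k, where k counts the points of
  \<open>T\<close> above \<open>s\<close>, so \<open>p\<close> changes sign between neighbours. The
  induction adds a new smallest point \<open>m\<close>: it contributes only positive factors
  \<open>s - m\<close> at the older points, so the sign condition passes to \<open>T\<close>. The
  bounds by \<open>Min\<close> and \<open>Max\<close> keep the new root apart from the earlier
  ones.\<close>

lemma interlacing_roots:
  fixes p :: "real poly"
  assumes "finite T" "T \<noteq> {}" "\<And>s. s \<in> T \<Longrightarrow> sgn (poly p s) = sgn (\<Prod>t\<in>T - {s}. s - t)"
  shows "\<exists>R. finite R \<and> Suc (card R) = card T \<and> (\<forall>r\<in>R. poly p r = 0 \<and> Min T < r \<and> r < Max T)"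
  using assms
proof (induction T rule: finite_linorder_min_induct)
  case empty
  then show ?case by simp
next
  case (insert m T)
  show ?case
  proof (cases "T = {}")
    case True
    then show ?thesis by (intro exI[of _ "{}"]) auto
  next
    case False
    have m_notin: "m \<notin> T" using insert.hyps by auto
    have sgn_T: "sgn (poly p s) = sgn (\<Prod>t\<in>T - {s}. s - t)" if "s \<in> T" for s
    proof -
      have "insert m T - {s} = insert m (T - {s})" using that m_notin by auto
      then have "(\<Prod>t\<in>insert m T - {s}. s - t) = (s - m) * (\<Prod>t\<in>T - {s}. s - t)"
        using insert.hyps m_notin by simp
      moreover have "sgn (s - m) = 1" using insert.hyps that by simp
      ultimately show ?thesis using insert.prems(2)[of s] that by (simp add: sgn_mult)
    qed
    from insert.IH[OF False sgn_T] obtain R where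
      R: "finite R" "Suc (card R) = card T" "\<forall>r\<in>R. poly p r = 0 \<and> Min T < r \<and> r < Max T"
      by blast
    define m' where "m' = Min T"
    have m': "m' \<in> T" "m < m'" "\<And>t. t \<in> T \<Longrightarrow> m' \<le> t"
      using insert.hyps False by (auto simp: m'_def)
    \<comment> \<open>Exactly one more point lies above \<open>m\<close> than above its neighbour
      \<open>m'\<close>, so the two values have opposite signs.\<close>
    have "sgn (poly p m) = (-1) ^ card T"
      using insert.prems(2)[of m] insert.hyps m_notin by (simp add: sgn_prod_less)
    moreover have "sgn (poly p m') = (-1) ^ card (T - {m'})"
      using sgn_T[OF m'(1)] insert.hyps(1) m'(3) by (subst (asm) sgn_prod_less) force+
    moreover have "card T = Suc (card (T - {m'}))"
      using insert.hyps(1) m'(1) by (metis card_Suc_Diff1)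
    ultimately have "sgn (poly p m * poly p m') = - 1"
      by (simp add: sgn_mult flip: power_add)
    then have "poly p m * poly p m' < 0"
      by (metis sgn_1_neg)
    then obtain r where r: "m < r" "r < m'" "poly p r = 0"
      using poly_IVT[OF m'(2)] by blast
    have "m' \<le> Max T" using insert.hyps(1) m'(1) by simp
    then have min_max: "Min (insert m T) = m" "Max (insert m T) = Max T" "m' \<le> Max T"
      using insert.hyps False m'(2) by (auto intro!: Min_eqI simp: max_def)
    have "r \<notin> R" using R(3) r by (auto simp: m'_def)
    show ?thesis
      by (rule exI[of _ "insert r R"])
        (use R r min_max m'(2) \<open>r \<notin> R\<close> insert.hyps m_notin in \<open>auto simp: m'_def\<close>)
  qed
qed

lemma prod_linear_factors_dvd:
  fixes p :: "'a :: idom poly"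
  assumes "finite R" "\<And>r. r \<in> R \<Longrightarrow> poly p r = 0"
  shows "(\<Prod>r\<in>R. [:- r, 1:]) dvd p"
  using assms
proof (induction R rule: finite_induct)
  case (insert r R)
  then obtain q where q: "p = (\<Prod>r\<in>R. [:- r, 1:]) * q" by auto
  \<comment> \<open>Since \<open>r\<close> is not in \<open>R\<close>, it cannot be a root of the
    part already split off and must be a root of the cofactor.\<close>
  have "poly (\<Prod>r\<in>R. [:- r, 1:]) r \<noteq> 0"
    using insert.hyps by (auto simp: poly_prod)
  then have "poly q r = 0" using insert.prems[of r] by (simp add: q)
  then obtain q' where "q = [:- r, 1:] * q'" by (auto simp: poly_eq_0_iff_dvd)
  then have "p = (\<Prod>r\<in>insert r R. [:- r, 1:]) * q'"
    using insert.hyps by (simp only: q prod.insert[OF insert.hyps(1,2)] mult_ac)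
  then show ?case by (rule dvdI)
qed simp

section \<open>Refined inertia from the roots\<close>

text \<open>Passing to the multiset of complex roots makes the count additive over a factorisation
  of the characteristic polynomial.\<close>

lemma eigenvalue_count_proots:
  assumes "B \<in> carrier_mat n n"
  shows "eigenvalue_count B P = size (filter_mset P (proots (map_poly complex_of_real (char_poly B))))"
proof -
  let ?p = "map_poly complex_of_real (char_poly B)"
  have cp: "char_poly (map_mat complex_of_real B) = ?p"
    using of_real_hom.char_poly_hom[OF assms] .
  have "?p \<noteq> 0"
    using degree_monic_char_poly[OF assms] by auto
  have "eigenvalue (map_mat complex_of_real B) z \<longleftrightarrow> poly ?p z = 0" for z
    using eigenvalue_root_char_poly[of "map_mat complex_of_real B" n z] assms by (simp add: cp)
  then have "eigenvalue_count B P = (\<Sum>z | poly ?p z = 0 \<and> P z. order z ?p)"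
    unfolding eigenvalue_count_def cp by simp
  also have "\<dots> = size (filter_mset P (proots ?p))"
    unfolding size_multiset_overloaded_eq using \<open>?p \<noteq> 0\<close>
    by (intro sum.cong) auto
  finally show ?thesis .
qed


lemma sgn_poly_minus_infinity:
  fixes p :: "real poly"
  assumes "lead_coeff p > 0"
  shows "\<exists>x<y. sgn (poly p x) = (-1) ^ degree p"
proof -
  \<comment> \<open>Reflecting the argument and correcting the sign preserves the leading
    coefficient, so behaviour at minus infinity becomes behaviour at plus infinity.\<close>
  define q where "q = Polynomial.smult ((-1) ^ degree p) (pcompose p [:0, -1:])"
  have lc: "lead_coeff q = lead_coeff p"
    using lead_coeff_comp[of "[:0, -1:]" p] by (simp add: q_def flip: power_mult_distrib)
  then obtain N where N: "\<And>x. x \<ge> N \<Longrightarrow> poly q x \<ge> lead_coeff q"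
    using poly_pinfty_gt_lc[of q] assms by auto
  define x where "x = max N (1 - y)"
  have "poly q x > 0" using N[of x] lc assms by (simp add: x_def)
  then have "sgn ((-1) ^ degree p * poly p (- x)) = 1"
    by (simp add: q_def poly_pcompose)
  then have "sgn (poly p (- x)) = (-1) ^ degree p"
    by (cases "even (degree p)") (auto simp: sgn_mult sgn_minus)
  then show ?thesis by (intro exI[of _ "- x"]) (auto simp: x_def)
qed

text \<open>Here \<open>u\<close> and \<open>v\<close> play the roots of a real monic quadratic with
  positive constant term: they are real of equal sign or complex conjugates.\<close>

lemma Re_pair_cases:
  assumes "Im (u + v) = 0" "Im (u * v) = 0" "Re (u * v) > 0"
  obtains "Re u > 0" "Re v > 0" | "Re u < 0" "Re v < 0"
    | "Re u = 0" "Re v = 0" "u \<noteq> 0" "v \<noteq> 0"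
proof -
  have im: "Im v = - Im u" using assms(1) by simp
  have "Im u * (Re v - Re u) = 0" using assms(2) by (simp add: im algebra_simps)
  then consider "Im u = 0" | "Re u = Re v" by auto
  then show thesis
  proof cases
    case 1
    then have "Re u * Re v > 0" using assms(3) by (simp add: im)
    then show thesis using that by (auto simp: zero_less_mult_iff)
  next
    case 2
    have "u \<noteq> 0" "v \<noteq> 0" using assms(3) by auto
    then show thesis using 2 that by (cases "Re u" "0 :: real" rule: linorder_cases) auto
  qed
qed

text \<open>The \<open>n - 1\<close> alternation points give \<open>n - 2\<close> distinct roots
  below \<open>Max T\<close>, hence negative. Dividing them out leaves a monic real quadratic that
  is positive at 0; its two roots select the member of \<open>H_set n\<close>.\<close>

lemma refined_inertia_in_H_set:
  assumes B: "B \<in> carrier_mat n n" and "n \<ge> 2"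
    and T: "finite T" "card T = n - 1" "\<And>s. s \<in> T \<Longrightarrow> s \<le> 0"
    and sgn: "\<And>s. s \<in> T \<Longrightarrow> sgn (poly (char_poly B) s) = sgn (\<Prod>t\<in>T - {s}. s - t)"
    and pos: "poly (char_poly B) 0 > 0"
  shows "refined_inertia B \<in> H_set n"
proof -
  interpret poly_of_real: map_poly_comm_ring_hom complex_of_real ..
  let ?p = "char_poly B"
  have p: "degree ?p = n" "lead_coeff ?p = 1"
    using degree_monic_char_poly[OF B] by auto
  have "T \<noteq> {}" using T \<open>n \<ge> 2\<close> by auto
  then obtain R where R: "finite R" "Suc (card R) = card T"
    "\<And>r. r \<in> R \<Longrightarrow> poly ?p r = 0" "\<And>r. r \<in> R \<Longrightarrow> r < Max T"
    using interlacing_roots[OF T(1) _ sgn] by auto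
  have "Max T \<le> 0" using T \<open>T \<noteq> {}\<close> by simp
  then have neg: "r < 0" if "r \<in> R" for r
    using R(4)[OF that] by linarith
  have card_R: "card R = n - 2" using R(2) T(2) by simp
  define Q where "Q = (\<Prod>r\<in>R. [:- r, 1:])"
  obtain q where q: "?p = Q * q"
    using prod_linear_factors_dvd[of R ?p] R by (auto simp: Q_def)
  have "degree Q = n - 2"
    by (simp add: Q_def degree_prod_sum_eq card_R)
  moreover have "lead_coeff Q = 1"
    unfolding Q_def lead_coeff_prod by simp
  ultimately have Q: "degree Q = n - 2" "lead_coeff Q = 1"
    by blast+
  have "Q \<noteq> 0" "q \<noteq> 0" using p q by auto
  then have "degree q = 2"
    using p Q \<open>n \<ge> 2\<close> by (auto simp: q degree_mult_eq)
  moreover have "lead_coeff q = 1"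
    using p(2) Q(2) unfolding q lead_coeff_mult by simp
  ultimately have q2: "degree q = 2" "lead_coeff q = 1"
    by blast+
  \<comment> \<open>At 0 each linear factor equals \<open>- r\<close>, which is positive.\<close>
  have "poly Q 0 > 0"
    using neg by (auto simp: Q_def poly_prod intro!: prod_pos)
  then have q0: "poly q 0 > 0" using pos by (simp add: q zero_less_mult_iff)
  let ?Q = "map_poly complex_of_real Q" and ?q = "map_poly complex_of_real q"
  have "?Q \<noteq> 0" "?q \<noteq> 0" using \<open>Q \<noteq> 0\<close> \<open>q \<noteq> 0\<close> by simp_all
  have "size (proots ?q) = 2"
    using q2 by (simp add: size_proots_complex)
  then obtain u M where M: "proots ?q = add_mset u M" "size M = 1"
    by (cases "proots ?q") auto
  then obtain v where uv: "proots ?q = {#u, v#}"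
    using size_1_singleton_mset[OF M(2)] by auto
  have "?q = [:- u, 1:] * [:- v, 1:]"
    using complex_poly_decompose_multiset[of ?q] q2 by (simp add: uv)
  then have fac: "?q = [:u * v, - (u + v), 1:]" by simp
  have "complex_of_real (coeff q 0) = u * v" "complex_of_real (coeff q 1) = - (u + v)"
    using arg_cong[OF fac, of "\<lambda>p. coeff p 0"] arg_cong[OF fac, of "\<lambda>p. coeff p 1"]
    by (simp_all add: coeff_map_poly)
  \<comment> \<open>Vieta: sum and product of the roots are, up to sign, real coefficients of
    \<open>q\<close>, and the product is \<open>poly q 0\<close>.\<close>
  then have sym: "Im (u + v) = 0" "Im (u * v) = 0" "Re (u * v) > 0"
    using q0 by (metis Im_complex_of_real minus_minus uminus_complex.sel(2) neg_equal_zero,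
        metis Im_complex_of_real, metis Re_complex_of_real poly_0_coeff_0)
  have proots_Q: "proots ?Q = image_mset complex_of_real (mset_set R)"
  proof -
    have "?Q = (\<Prod>r\<in>R. [:- complex_of_real r, 1:])"
      unfolding Q_def poly_of_real.hom_prod by simp
    then show ?thesis
      by (simp add: proots_prod sum_unfold_sum_mset image_mset.compositionality comp_def)
  qed
  have count: "eigenvalue_count B P =
      size (filter_mset P {#u, v#}) + card {r \<in> R. P (complex_of_real r)}" for P
  proof -
    have "map_poly complex_of_real ?p = ?Q * ?q"
      unfolding q by (rule poly_of_real.hom_mult)
    then have "proots (map_poly complex_of_real ?p) = proots ?Q + {#u, v#}"
      using \<open>?Q \<noteq> 0\<close> \<open>?q \<noteq> 0\<close> uv by (simp add: proots_mult)
    then show ?thesis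
      using R(1) by (simp add: eigenvalue_count_proots[OF B] proots_Q filter_mset_image_mset)
  qed
  \<comment> \<open>Each of the four predicates of the refined inertia holds for all negative reals
    or for none, so \<open>R\<close> contributes \<open>n - 2\<close> or 0.\<close>
  have card_all: "card {r \<in> R. P r} = n - 2" if "\<And>r. r < 0 \<Longrightarrow> P r" for P
    using that neg card_R by (metis (mono_tags, lifting) Collect_cong Collect_mem_eq)
  have card_none: "card {r \<in> R. P r} = 0" if "\<And>r. r < 0 \<Longrightarrow> \<not> P r" for P
    using that neg by (auto simp: card_eq_0_iff)
  have counts:
    "eigenvalue_count B (\<lambda>z. Re z > 0) = size {#z \<in># {#u, v#}. Re z > 0#}"
    "eigenvalue_count B (\<lambda>z. Re z < 0) = size {#z \<in># {#u, v#}. Re z < 0#} + (n - 2)"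
    "eigenvalue_count B (\<lambda>z. z = 0) = size {#z \<in># {#u, v#}. z = 0#}"
    "eigenvalue_count B (\<lambda>z. Re z = 0 \<and> z \<noteq> 0) = size {#z \<in># {#u, v#}. Re z = 0 \<and> z \<noteq> 0#}"
    by (subst count, (subst card_all card_none; simp))+
  from sym show ?thesis
    by (rule Re_pair_cases) (use \<open>n \<ge> 2\<close> in \<open>auto simp: refined_inertia_def H_set_def counts\<close>)
qed

section \<open>The characteristic polynomial of \<open>matrix_B\<close> and its values at the
  nodes\<close>

text \<open>The diagonal entry in the 1-based row \<open>i >= 2\<close>. Row 2 is separate because
  \<open>i - 2\<close> would point to \<open>b 0\<close>, which is not a parameter of the
  matrix.\<close>

definition node :: "(nat \<Rightarrow> real) \<Rightarrow> nat \<Rightarrow> real" where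
  "node b i = (if i = 2 then 0 else - b (i - 2))"

text \<open>The arrow determinant divides by \<open>x - node b i\<close>, so both sides are first
  compared at points \<open>x\<close> that are not nodes. If the polynomials differed, they could
  agree at only finitely many reals.\<close>

lemma char_poly_matrix_B:
  assumes "n > 0"
  shows "char_poly (matrix_B n a b) = [:- a 1, 1:] * (\<Prod>i\<in>{2..n}. [:- node b i, 1:])
    - (\<Sum>i\<in>{2..n}. Polynomial.smult (a i) (\<Prod>j\<in>{2..n} - {i}. [:- node b j, 1:]))" (is "?p = ?q")
proof (rule ccontr)
  assume "?p \<noteq> ?q"
  have B: "matrix_B n a b \<in> carrier_mat n n" by (simp add: matrix_B_def mat1_def)
  have range: "{2..n} = Suc ` {1..<n}"
    by (simp add: atLeastLessThanSuc_atLeastAtMost numeral_2_eq_2)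
  have eq: "poly ?p x = poly ?q x" if x: "x \<notin> node b ` {2..n}" for x
  proof -
    have nz: "x - node b i \<noteq> 0" if "i \<in> {2..n}" for i using x that by auto
    define d where "d i = (if i = 0 then x - a 1 else x - node b (Suc i))" for i
    \<comment> \<open>This is xI - B, again an arrow matrix, with both arms negated; the two signs
      cancel in the Schur complement.\<close>
    have "- char_matrix (matrix_B n a b) x =
        mat n n (\<lambda>(i, j). if i = j then d i else if i = 0 then - 1 else if j = 0 then - a (Suc i) else 0)"
      by (rule eq_matI) (auto simp: char_matrix_def matrix_B_def mat1_def d_def node_def)
    then have "poly ?p x = (d 0 - (\<Sum>i\<in>{1..<n}. - 1 * - a (Suc i) / d i)) * (\<Prod>i\<in>{1..<n}. d i)"
      using det_arrow[of n d] assms nz by (auto simp: char_poly_matrix[OF B] d_def range)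
    also have "\<dots> = (x - a 1 - (\<Sum>i\<in>{2..n}. a i / (x - node b i))) * (\<Prod>i\<in>{2..n}. x - node b i)"
      unfolding range sum.reindex[OF inj_Suc] prod.reindex[OF inj_Suc] by (simp add: d_def)
    also have "\<dots> = (x - a 1) * (\<Prod>i\<in>{2..n}. x - node b i)
        - (\<Sum>i\<in>{2..n}. a i * (\<Prod>j\<in>{2..n} - {i}. x - node b j))"
    proof -
      have "a i / (x - node b i) * (\<Prod>i\<in>{2..n}. x - node b i) = a i * (\<Prod>j\<in>{2..n} - {i}. x - node b j)"
        if "i \<in> {2..n}" for i
        using that nz[OF that] by (simp add: prod.remove[of "{2..n}" i])
      then show ?thesis by (simp add: left_diff_distrib sum_distrib_right)
    qed
    also have "\<dots> = poly ?q x"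
      by (simp add: poly_sum poly_prod algebra_simps)
    finally show ?thesis .
  qed
  have "UNIV \<subseteq> {x. poly (?p - ?q) x = 0} \<union> node b ` {2..n}"
    using eq by auto
  moreover have "finite ({x. poly (?p - ?q) x = 0} \<union> node b ` {2..n})"
    using poly_roots_finite[of "?p - ?q"] \<open>?p \<noteq> ?q\<close> by auto
  ultimately show False
    using infinite_UNIV_char_0[where ?'a = real] finite_subset by blast
qed

text \<open>Every term except the one for \<open>i = k\<close> contains the factor that vanishes at
  \<open>node b k\<close>.\<close>

lemma poly_char_poly_node:
  assumes "k \<in> {2..n}"
  shows "poly (char_poly (matrix_B n a b)) (node b k) =
    - a k * (\<Prod>j\<in>{2..n} - {k}. node b k - node b j)"
proof -
  have "(\<Prod>j\<in>{2..n} - {i}. node b k - node b j) = 0" if "i \<noteq> k" for i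
    using assms that by (intro prod_zero) auto
  then have "(\<Sum>i\<in>{2..n}. a i * (\<Prod>j\<in>{2..n} - {i}. node b k - node b j)) =
      (\<Sum>i\<in>{2..n}. if i = k then a k * (\<Prod>j\<in>{2..n} - {k}. node b k - node b j) else 0)"
    by (intro sum.cong) auto
  then show ?thesis
    using assms prod_zero[of "{2..n}" "\<lambda>i. node b k - node b i"]
    by (auto simp: char_poly_matrix_B poly_sum poly_prod)
qed

text \<open>Since 0 is \<open>node b 2\<close>, this is the evaluation at a node for
  \<open>k = 2\<close>, where the differences of nodes are the \<open>b j\<close>.\<close>

lemma poly_char_poly_0:
  assumes "n \<ge> 2"
  shows "poly (char_poly (matrix_B n a b)) 0 = - a 2 * (\<Prod>j\<in>{1..n - 2}. b j)"
proof -
  have "(\<Prod>j\<in>{2..n} - {2}. node b 2 - node b j) = (\<Prod>j\<in>{1..n - 2}. b j)"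
    by (rule prod.reindex_bij_witness[of _ "\<lambda>j. j + 2" "\<lambda>j. j - 2"]) (auto simp: node_def)
  then show ?thesis
    using poly_char_poly_node[of 2 n a b] assms by (simp add: node_def)
qed

section \<open>Alternation along the nodes\<close>

lemma prod_image_diff:
  assumes "inj_on f I" "k \<in> I"
  shows "(\<Prod>t\<in>f ` I - {f k}. f k - t) = (\<Prod>j\<in>I - {k}. f k - f j :: 'a :: comm_ring_1)"
proof -
  have "f ` I - {f k} = f ` (I - {k})" using assms by (auto simp: inj_on_def)
  then show ?thesis using assms by (simp add: prod.reindex inj_on_diff)
qed

text \<open>With all \<open>a k\<close> negative, the factor \<open>- a k\<close> in the value at a
  node is positive, so the \<open>n - 1\<close> nodes themselves are the alternation points.\<close>

lemma refined_inertia_all_nodes: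
  assumes "n \<ge> 2" "inj_on (node b) {2..n}"
    and "\<And>k. k \<in> {2..n} \<Longrightarrow> a k < 0" "\<And>k. k \<in> {2..n} \<Longrightarrow> node b k \<le> 0"
    and pos: "poly (char_poly (matrix_B n a b)) 0 > 0"
  shows "refined_inertia (matrix_B n a b) \<in> H_set n"
proof (rule refined_inertia_in_H_set[of _ _ "node b ` {2..n}"])
  fix s assume "s \<in> node b ` {2..n}"
  then obtain k where "k \<in> {2..n}" "s = node b k" by auto
  then show "sgn (poly (char_poly (matrix_B n a b)) s) = sgn (\<Prod>t\<in>node b ` {2..n} - {s}. s - t)"
    using assms(3) by (simp add: prod_image_diff[OF assms(2)] poly_char_poly_node sgn_mult)
qed (use assms in \<open>auto simp: card_image matrix_B_def mat1_def\<close>)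

text \<open>Dropping the largest node \<open>e\<close> flips the sign of every product over the other nodes, which makes up for
  the positive \<open>a k\<close>; the missing alternation point is taken far to the left.\<close>

lemma refined_inertia_all_but_largest_node:
  assumes "n \<ge> 2" "inj_on (node b) {2..n}" and e: "e \<in> {2..n}"
    and less: "\<And>k. k \<in> {2..n} - {e} \<Longrightarrow> node b k < node b e"
    and a: "\<And>k. k \<in> {2..n} - {e} \<Longrightarrow> a k > 0"
    and le: "\<And>k. k \<in> {2..n} - {e} \<Longrightarrow> node b k \<le> 0"
    and pos: "poly (char_poly (matrix_B n a b)) 0 > 0"
  shows "refined_inertia (matrix_B n a b) \<in> H_set n"
proof -
  let ?p = "char_poly (matrix_B n a b)"
  define T where "T = node b ` ({2..n} - {e})"
  have B: "matrix_B n a b \<in> carrier_mat n n" by (simp add: matrix_B_def mat1_def)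
  have inj: "inj_on (node b) ({2..n} - {e})" using assms(2) by (rule inj_on_diff)
  have T: "finite T" "card T = n - 2" using e by (auto simp: T_def card_image[OF inj])
  \<comment> \<open>Inserting 0 forces \<open>x < 0\<close> and keeps \<open>Min\<close> meaningful
    when \<open>T\<close> is empty.\<close>
  obtain x where x: "x < Min (insert 0 T)" "sgn (poly ?p x) = (-1) ^ n"
    using sgn_poly_minus_infinity[of ?p "Min (insert 0 T)"] degree_monic_char_poly[OF B] by auto
  have x_less: "x < 0" "\<And>t. t \<in> T \<Longrightarrow> x < t" using x(1) T(1) by simp_all
  show ?thesis
  proof (rule refined_inertia_in_H_set[OF B \<open>n \<ge> 2\<close>, of "insert x T"])
    show "card (insert x T) = n - 1" using T x_less \<open>n \<ge> 2\<close> by (auto simp: card_insert_if)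
    show "s \<le> 0" if "s \<in> insert x T" for s using that x_less le by (fastforce simp: T_def)
    show "sgn (poly ?p s) = sgn (\<Prod>t\<in>insert x T - {s}. s - t)" if s: "s \<in> insert x T" for s
    proof (cases "s = x")
      case True
      then have "insert x T - {s} = T" using x_less by auto
      \<comment> \<open>The degree \<open>n\<close> and the number \<open>n - 2\<close> of points
        above \<open>x\<close> have the same parity.\<close>
      moreover have "(-1) ^ n = ((-1) ^ (n - 2) :: real)" using \<open>n \<ge> 2\<close> by (simp add: power_diff)
      ultimately show ?thesis using True T x_less x(2) by (simp add: sgn_prod_less)
    next
      case False
      then obtain k where k: "k \<in> {2..n} - {e}" "s = node b k" using s unfolding T_def by blast
      define P where "P = (\<Prod>j\<in>{2..n} - {e} - {k}. s - node b j)"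
      have "{2..n} - {k} = insert e ({2..n} - {e} - {k})" using e k by auto
      then have "poly ?p s = a k * (node b e - s) * P"
        using k by (simp add: poly_char_poly_node P_def algebra_simps)
      moreover have "insert x T - {s} = insert x (T - {s})" "x \<notin> T - {s}" using False x_less by auto
      then have "(\<Prod>t\<in>insert x T - {s}. s - t) = (s - x) * P"
        using T(1) k prod_image_diff[OF inj k(1)] by (simp add: P_def T_def)
      moreover have "sgn (a k) = 1" "sgn (node b e - s) = 1" "sgn (s - x) = 1"
        using a[OF k(1)] less[OF k(1)] x_less(2)[of s] k by (auto simp: T_def)
      ultimately show ?thesis by (simp add: sgn_mult)
    qed
  qed (use T pos in auto)
qed

section \<open>Signs read off from the three patterns\<close>

theorem theorem3p1:
  fixes n :: nat and a b :: "nat \<Rightarrow> real"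
  assumes "n \<ge> 5"
    and "\<And>j. j \<in> {1..n - 3} \<Longrightarrow> b j > 0"
    and "matrix_B n a b \<in> qual_class (pattern_A1 n) \<union> qual_class (pattern_A2 n) \<union> qual_class (pattern_A3 n)"
    and "inj_on b {1..n - 2}"
  shows "refined_inertia (matrix_B n a b) \<in> H_set n"
proof -
  have sgn_eq: "sign_of x = SPos \<longleftrightarrow> x > 0" "sign_of x = SNeg \<longleftrightarrow> x < 0" for x
    by (auto simp: sign_of_def)
  have entry: "sign_of (matrix_B n a b $$ (i - 1, j - 1)) = A $$ (i - 1, j - 1)"
    if "matrix_B n a b \<in> qual_class A" "i \<in> {1..n}" "j \<in> {1..n}" for A i j
  proof -
    have "map_mat sign_of (matrix_B n a b) = A" using that(1) by (simp add: qual_class_def)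
    then show ?thesis using that(2,3) by (auto simp: matrix_B_def mat1_def)
  qed
  have diag: "matrix_B n a b $$ (n - 1, n - 1) = - b (n - 2)"
    and col: "\<And>i. i \<in> {1..n} \<Longrightarrow> matrix_B n a b $$ (i - 1, 1 - 1) = a i"
    using \<open>n \<ge> 5\<close> by (auto simp: matrix_B_def mat1_def)
  have split: "{1..n - 2} = insert (n - 2) {1..n - 3}" using \<open>n \<ge> 5\<close> by auto
  \<comment> \<open>Distinct \<open>b j\<close> do not yet separate the other nodes from
    \<open>node b 2 = 0\<close>. That \<open>b (n - 2)\<close> is nonzero comes only from the
    pattern, so it stays a premise here.\<close>
  have inj: "inj_on (node b) {2..n}" if "b (n - 2) \<noteq> 0"
  proof (rule inj_onI)
    have b0: "b j \<noteq> 0" if "j \<in> {1..n - 2}" for j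
      using that assms(2)[of j] \<open>b (n - 2) \<noteq> 0\<close> unfolding split by auto
    fix i j assume ij: "i \<in> {2..n}" "j \<in> {2..n}" "node b i = node b j"
    have mem: "k - 2 \<in> {1..n - 2}" if "k \<in> {2..n}" "k \<noteq> 2" for k using that by auto
    show "i = j"
    proof (cases "i = 2 \<or> j = 2")
      case True
      then show ?thesis
        using ij b0[OF mem[of i]] b0[OF mem[of j]] by (auto simp: node_def split: if_splits)
    next
      case False
      then have "i - 2 = j - 2"
        using ij mem by (intro inj_onD[OF assms(4)]) (auto simp: node_def)
      then show ?thesis using ij(1,2) False by auto
    qed
  qed
  have node_neg: "node b k < 0" if "k \<in> {3..<n}" for k
  proof -
    have "k - 2 \<in> {1..n - 3}" using that by auto
    then show ?thesis using assms(2) that by (simp add: node_def)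
  qed
  have node_2: "node b 2 = 0" and node_n: "node b n = - b (n - 2)"
    using \<open>n \<ge> 5\<close> by (auto simp: node_def)
  have node_neg_all: "node b k < 0" if "k \<in> {3..n}" "b (n - 2) > 0" for k
  proof -
    have "k = n \<or> k \<in> {3..<n}" using that(1) unfolding atLeastAtMost_iff atLeastLessThan_iff by linarith
    then show ?thesis using that node_n node_neg by auto
  qed
  \<comment> \<open>The factor \<open>b (n - 2)\<close> is split off because its sign depends on the
    pattern; in all three, \<open>a 2\<close> and \<open>b (n - 2)\<close> have opposite
    signs.\<close>
  have p0: "poly (char_poly (matrix_B n a b)) 0 = - a 2 * b (n - 2) * (\<Prod>j\<in>{1..n - 3}. b j)"
  proof -
    have "(\<Prod>j\<in>{1..n - 2}. b j) = b (n - 2) * (\<Prod>j\<in>{1..n - 3}. b j)"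
      unfolding split using \<open>n \<ge> 5\<close> by (subst prod.insert) auto
    then show ?thesis using \<open>n \<ge> 5\<close> by (simp add: poly_char_poly_0)
  qed
  have prod_pos: "(\<Prod>j\<in>{1..n - 3}. b j) > 0" using assms(2) by (intro prod_pos) auto
  consider "matrix_B n a b \<in> qual_class (pattern_A1 n)" | "matrix_B n a b \<in> qual_class (pattern_A2 n)"
    | "matrix_B n a b \<in> qual_class (pattern_A3 n)"
    using assms(3) by blast
  then show ?thesis
  proof cases
    case 1
    have a: "a k < 0" if "k \<in> {2..n}" for k
      using entry[OF 1, of k 1] col[of k] that by (auto simp: pattern_A1_def mat1_def sgn_eq)
    have b: "b (n - 2) > 0"
      using entry[OF 1, of n n] diag \<open>n \<ge> 5\<close> by (auto simp: pattern_A1_def mat1_def sgn_eq)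
    have "node b k \<le> 0" if "k \<in> {2..n}" for k
      using that node_2 b node_neg_all[of k] by (cases "k = 2") auto
    moreover have "poly (char_poly (matrix_B n a b)) 0 > 0"
      using a[of 2] b prod_pos \<open>n \<ge> 5\<close> by (simp add: p0 mult_neg_pos)
    ultimately show ?thesis
      using refined_inertia_all_nodes[of n b a] inj a b \<open>n \<ge> 5\<close> by auto
  next
    case 2
    have a2: "a 2 < 0"
      using entry[OF 2, of 2 1] col[of 2] \<open>n \<ge> 5\<close> by (auto simp: pattern_A2_def mat1_def sgn_eq)
    have a: "a k > 0" if "k \<in> {3..n}" for k
      using entry[OF 2, of k 1] col[of k] that by (auto simp: pattern_A2_def mat1_def sgn_eq)
    have b: "b (n - 2) > 0"
      using entry[OF 2, of n n] diag \<open>n \<ge> 5\<close> by (auto simp: pattern_A2_def mat1_def sgn_eq)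
    have "node b k < 0" if "k \<in> {3..n}" for k
      using that b by (rule node_neg_all)
    moreover have "poly (char_poly (matrix_B n a b)) 0 > 0"
      using a2 b prod_pos by (simp add: p0 mult_neg_pos)
    moreover have "{2..n} - {2} = {3..n}" by auto
    \<comment> \<open>The dropped node is \<open>node b 2 = 0\<close>, the largest as all others are
      negative; it is also the one with \<open>a 2 < 0\<close>.\<close>
    ultimately show ?thesis
      using refined_inertia_all_but_largest_node[of n b 2 a] inj a b node_2 \<open>n \<ge> 5\<close>
      by (auto simp: less_imp_le)
  next
    case 3
    have a: "a k > 0" if "k \<in> {2..<n}" for k
      using entry[OF 3, of k 1] col[of k] that by (auto simp: pattern_A3_def mat1_def sgn_eq)
    have b: "b (n - 2) < 0"
      using entry[OF 3, of n n] diag \<open>n \<ge> 5\<close> by (auto simp: pattern_A3_def mat1_def sgn_eq)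
    have le: "node b k \<le> 0" if "k \<in> {2..<n}" for k
      using that node_2 node_neg[of k] by (cases "k = 2") auto
    moreover have "node b k < node b n" if "k \<in> {2..<n}" for k
      using le[OF that] node_n b by simp
    moreover have "poly (char_poly (matrix_B n a b)) 0 > 0"
      using a[of 2] b prod_pos \<open>n \<ge> 5\<close> by (simp add: p0 mult_pos_neg mult_neg_pos)
    moreover have "{2..n} - {n} = {2..<n}" by auto
    \<comment> \<open>The dropped node is \<open>node b n\<close>, the only positive one.\<close>
    ultimately show ?thesis
      using refined_inertia_all_but_largest_node[of n b n a] inj a b \<open>n \<ge> 5\<close> by auto
  qed
qed

end
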